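(* Let $X,Y$ be complex Banach sequence lattices. Suppose that $X$ and $Y$ are $p$-convex with constant one for some $p>2$. For every $\varepsilon>0$ there exists $\eta>0$ such that the following holds: whenever $F,G\subseteq\mathbb{N}$ are finite, $x_0\in S_X$ and $y_0\in S_Y$ are supported on $F$ and $G$, respectively, and $A\in B_{\mathcal{L}(^2X\times Y;\mathbb{C})}$ satisfies $|A(x_0,y_0)|>1-\eta$, then $$\|A-R_{F,G}A\|<\varepsilon ,$$ where $R_{F,G}A(x,y):=A(\pi_Fx,\pi_Gy)$ for $(x,y)\in X\times Y$.
   Context: $B_E$ and $S_E$ denote the closed unit ball and the unit sphere of a Banach space $E$. A complex Banach sequence lattice is a linear subspace $X\subseteq\mathbb{C}^{\mathbb{N}}$ containing $c_{00}$ (the finitely supported sequences) which is a Banach space under a norm $\|\cdot\|_X$ and such that whenever $x\in X$, $y\in\mathbb{C}^{\mathbb{N}}$ and $|y(k)|\le|x(k)|$ for every $k$, then $y\in X$ and $\|y\|_X\le\|x\|_X$. For $1\le r<\infty$, $X$ is $r$-convex with constant one if $\big\|\big(\sum_{j=1}^m|x^j|^r\big)^{1/r}\big\|_X\le\big(\sum_{j=1}^m\|x^j\|_X^r\big)^{1/r}$ for every finite family $x^1,\dots,x^m\in X$, where the powers, sums and roots of sequences are taken coordinatewise. For finite $F\subseteq\mathbb{N}$, $\pi_F$ is the coordinate projection $\pi_F(x)=\sum_{k\in F}x(k)e_k$. $\mathcal{L}(^2X\times Y;\mathbb{C})$ is the Banach space of continuous bilinear forms $A:X\times Y\to\mathbb{C}$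 with norm $\|A\|=\sup\{|A(x,y)|:x\in B_X,\,y\in B_Y\}$. *)

theory Defs
  imports "HOL-Analysis.Analysis"
begin

text \<open>Sequence spaces are given by a carrier set \<open>X\<close> of sequences and a function \<open>N\<close> whose values
  matter on \<open>X\<close> only.\<close>

locale normed_sequence_space =
  fixes X :: "(nat \<Rightarrow> complex) set" and N :: "(nat \<Rightarrow> complex) \<Rightarrow> real"
  assumes zero_mem: "(\<lambda>k. 0) \<in> X"
    and add_mem: "\<lbrakk>x \<in> X; y \<in> X\<rbrakk> \<Longrightarrow> (\<lambda>k. x k + y k) \<in> X"
    and scale_mem: "x \<in> X \<Longrightarrow> (\<lambda>k. c * x k) \<in> X"
    and norm_nonneg: "x \<in> X \<Longrightarrow> 0 \<le> N x"
    and norm_eq_0_iff: "x \<in> X \<Longrightarrow> N x = 0 \<longleftrightarrow> x = (\<lambda>k. 0)"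
    and norm_triangle: "\<lbrakk>x \<in> X; y \<in> X\<rbrakk> \<Longrightarrow> N (\<lambda>k. x k + y k) \<le> N x + N y"
    and norm_scale: "x \<in> X \<Longrightarrow> N (\<lambda>k. c * x k) = cmod c * N x"

text \<open>The locale \<open>Metric_space\<close> requires nonnegativity and symmetry of the distance on the whole type,
  hence the value \<open>0\<close> off the carrier.\<close>

definition seq_dist ::
  "(nat \<Rightarrow> complex) set \<Rightarrow> ((nat \<Rightarrow> complex) \<Rightarrow> real) \<Rightarrow> (nat \<Rightarrow> complex) \<Rightarrow> (nat \<Rightarrow> complex) \<Rightarrow> real" where
  "seq_dist X N x y = (if x \<in> X \<and> y \<in> X then N (\<lambda>k. x k - y k) else 0)"

lemma (in normed_sequence_space) diff_mem:
  assumes "x \<in> X" "y \<in> X"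
  shows "(\<lambda>k. x k - y k) \<in> X"
  using add_mem[OF assms(1) scale_mem[OF assms(2), of "-1"]] by simp

lemma (in normed_sequence_space) Metric_space_seq_dist: "Metric_space X (seq_dist X N)"
proof
  fix x y z
  show "0 \<le> seq_dist X N x y"
    by (simp add: seq_dist_def diff_mem norm_nonneg)
  show "seq_dist X N x y = seq_dist X N y x"
    using norm_scale[OF diff_mem, of x y "-1"] by (auto simp: seq_dist_def)
  show "(seq_dist X N x y = 0) = (x = y)" if "x \<in> X" "y \<in> X"
    using that by (auto simp: seq_dist_def norm_eq_0_iff diff_mem fun_eq_iff)
  show "seq_dist X N x z \<le> seq_dist X N x y + seq_dist X N y z"
    if "x \<in> X" "y \<in> X" "z \<in> X"
    using that norm_triangle[OF diff_mem diff_mem, of x y y z] by (simp add: seq_dist_def)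
qed

locale banach_sequence_lattice = normed_sequence_space +
  assumes finite_support_mem: "finite {k. x k \<noteq> 0} \<Longrightarrow> x \<in> X"
    and complete: "Metric_space.mcomplete X (seq_dist X N)"
    and solid_mem: "\<lbrakk>x \<in> X; \<And>k. cmod (y k) \<le> cmod (x k)\<rbrakk> \<Longrightarrow> y \<in> X"
    and solid_norm: "\<lbrakk>x \<in> X; \<And>k. cmod (y k) \<le> cmod (x k)\<rbrakk> \<Longrightarrow> N y \<le> N x"

text \<open>\<open>r\<close>-convexity with constant one, for \<open>1 \<le> r\<close>.  The sequence on the left lies in a Banach
  sequence lattice \<open>X\<close> because it is dominated by \<open>\<Sum>j<m. |x j|\<close>.\<close>

definition convex_const_one ::
  "real \<Rightarrow> (nat \<Rightarrow> complex) set \<Rightarrow> ((nat \<Rightarrow> complex) \<Rightarrow> real) \<Rightarrow> bool" where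
  "convex_const_one r X N \<longleftrightarrow>
     (\<forall>(m::nat) x. (\<forall>j<m. x j \<in> X) \<longrightarrow>
        N (\<lambda>k. complex_of_real ((\<Sum>j<m. cmod (x j k) powr r) powr (1 / r)))
          \<le> (\<Sum>j<m. N (x j) powr r) powr (1 / r))"

definition unit_ball :: "(nat \<Rightarrow> complex) set \<Rightarrow> ((nat \<Rightarrow> complex) \<Rightarrow> real) \<Rightarrow> (nat \<Rightarrow> complex) set" where
  "unit_ball X N = {x \<in> X. N x \<le> 1}"

definition unit_sphere :: "(nat \<Rightarrow> complex) set \<Rightarrow> ((nat \<Rightarrow> complex) \<Rightarrow> real) \<Rightarrow> (nat \<Rightarrow> complex) set" where
  "unit_sphere X N = {x \<in> X. N x = 1}"

definition supported_on :: "(nat \<Rightarrow> complex) \<Rightarrow> nat set \<Rightarrow> bool" where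
  "supported_on x F \<longleftrightarrow> (\<forall>k. k \<notin> F \<longrightarrow> x k = 0)"

definition coord_proj :: "nat set \<Rightarrow> (nat \<Rightarrow> complex) \<Rightarrow> nat \<Rightarrow> complex" where
  "coord_proj F x = (\<lambda>k. if k \<in> F then x k else 0)"

type_synonym seq_form = "(nat \<Rightarrow> complex) \<Rightarrow> (nat \<Rightarrow> complex) \<Rightarrow> complex"

definition bilinear_form_on :: "(nat \<Rightarrow> complex) set \<Rightarrow> (nat \<Rightarrow> complex) set \<Rightarrow> seq_form \<Rightarrow> bool" where
  "bilinear_form_on X Y A \<longleftrightarrow>
     (\<forall>x\<in>X. \<forall>x'\<in>X. \<forall>y\<in>Y. A (\<lambda>k. x k + x' k) y = A x y + A x' y) \<and>
     (\<forall>c. \<forall>x\<in>X. \<forall>y\<in>Y. A (\<lambda>k. c * x k) y = c * A x y) \<and>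
     (\<forall>x\<in>X. \<forall>y\<in>Y. \<forall>y'\<in>Y. A x (\<lambda>k. y k + y' k) = A x y + A x y') \<and>
     (\<forall>c. \<forall>x\<in>X. \<forall>y\<in>Y. A x (\<lambda>k. c * y k) = c * A x y)"

definition continuous_bilinear_forms ::
  "(nat \<Rightarrow> complex) set \<Rightarrow> ((nat \<Rightarrow> complex) \<Rightarrow> real) \<Rightarrow>
   (nat \<Rightarrow> complex) set \<Rightarrow> ((nat \<Rightarrow> complex) \<Rightarrow> real) \<Rightarrow> seq_form set" where
  "continuous_bilinear_forms X NX Y NY =
     {A. bilinear_form_on X Y A \<and>
         continuous_map
           (prod_topology (Metric_space.mtopology X (seq_dist X NX))
                          (Metric_space.mtopology Y (seq_dist Y NY)))
           euclidean (\<lambda>(x, y). A x y)}"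

text \<open>The supremum is over a bounded set when \<open>A\<close> is a continuous bilinear form.\<close>

definition form_norm ::
  "(nat \<Rightarrow> complex) set \<Rightarrow> ((nat \<Rightarrow> complex) \<Rightarrow> real) \<Rightarrow>
   (nat \<Rightarrow> complex) set \<Rightarrow> ((nat \<Rightarrow> complex) \<Rightarrow> real) \<Rightarrow> seq_form \<Rightarrow> real" where
  "form_norm X NX Y NY A = Sup {cmod (A x y) |x y. x \<in> unit_ball X NX \<and> y \<in> unit_ball Y NY}"

definition form_unit_ball ::
  "(nat \<Rightarrow> complex) set \<Rightarrow> ((nat \<Rightarrow> complex) \<Rightarrow> real) \<Rightarrow>
   (nat \<Rightarrow> complex) set \<Rightarrow> ((nat \<Rightarrow> complex) \<Rightarrow> real) \<Rightarrow> seq_form set" where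
  "form_unit_ball X NX Y NY =
     {A \<in> continuous_bilinear_forms X NX Y NY. form_norm X NX Y NY A \<le> 1}"

definition restrict_form :: "nat set \<Rightarrow> nat set \<Rightarrow> seq_form \<Rightarrow> seq_form" where
  "restrict_form F G A = (\<lambda>x y. A (coord_proj F x) (coord_proj G y))"

end

theory Submission
  imports Defs
begin

text \<open>Let \<open>A\<close> have norm at most one and \<open>\<bar>A x0 y0\<bar> > 1 - \<eta>\<close>.  If \<open>u\<close> in the unit ball vanishes on \<open>F\<close>,
  then \<open>p\<close>-convexity gives \<open>\<parallel>x0 + t u\<parallel> \<le> 1 + t\<^sup>p\<close>.  If \<open>w\<close> in the unit ball is tangential to \<open>y0\<close>, that
  is \<open>Re (cnj (y0 k) * w k) = 0\<close> for all \<open>k\<close>, then \<open>\<bar>y0 + s w\<bar>\<^sup>2 = \<bar>y0\<bar>\<^sup>2 + s\<^sup>2\<bar>w\<bar>\<^sup>2\<close> and so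
  \<open>\<parallel>y0 + s w\<parallel> \<le> 1 + s\<^sup>2\<close>.  Averaging \<open>A (x0 + t u) (y0 + s w)\<close> over a simultaneous change of sign of
  \<open>t\<close> and \<open>s\<close> yields \<open>\<bar>A x0 y0\<bar> + t s \<bar>A u w\<bar> \<le> (1 + t\<^sup>p) (1 + s\<^sup>2)\<close>, so with \<open>s\<^sup>2 = t\<^sup>p = \<eta>\<close> the
  quantity \<open>\<bar>A u w\<bar>\<close> is of order \<open>t\<close> to the power \<open>p / 2 - 1\<close>.  This is small because \<open>p > 2\<close>.  Every
  sequence \<open>y\<close> equals \<open>w1 - \<i> w2\<close> with \<open>w1\<close> and \<open>w2\<close> tangential, so \<open>A u y\<close> is small for all \<open>y\<close>, and
  symmetrically in the other variable.\<close>

section \<open>Elementary inequalities for real powers and complex phases\<close>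

text \<open>The boundary cases \<open>x = 0\<close> and \<open>y = 0\<close> reduce to (m z)^q <= m
  z^q, which follows from m^q <= m for m in [0, 1].\<close>

lemma powr_convex_nonneg:
  fixes x y l q :: real
  assumes "1 \<le> q" "0 \<le> x" "0 \<le> y" "0 \<le> l" "l \<le> 1"
  shows "((1 - l) * x + l * y) powr q \<le> (1 - l) * x powr q + l * y powr q"
proof -
  have scaled: "(m * z) powr q \<le> m * z powr q" if "0 \<le> m" "m \<le> 1" "0 \<le> z" for m z :: real
  proof (cases "m = 0")
    case False
    then have "m powr q \<le> m"
      using that assms powr_le_one_le by simp
    then show ?thesis
      using that by (simp add: powr_mult mult_right_mono)
  qed auto
  consider "x = 0" | "y = 0" | "0 < x" "0 < y"
    using assms by linarith
  then show ?thesis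
  proof cases
    case 1
    then show ?thesis using scaled[of l y] assms by simp
  next
    case 2
    then show ?thesis using scaled[of "1 - l" x] assms by simp
  next
    case 3
    then show ?thesis
      using convex_onD[OF powr_convex[OF assms(1)], of l x y] assms by simp
  qed
qed

text \<open>Jensen's inequality with weights 1/(1+t) and t/(1+t): u + t v is (1+t) times the
  weighted mean of u and v, and one factor of (1+t)^q clears the weights on the right.\<close>

lemma powr_add_scaled_le:
  fixes u v t q :: real
  assumes "1 \<le> q" "0 \<le> u" "0 \<le> v" "0 \<le> t"
  shows "(u + t * v) powr q \<le> (1 + t) powr (q - 1) * (u powr q + t * v powr q)"
proof -
  define l where "l = t / (1 + t)"
  have l: "0 \<le> l" "l \<le> 1" "(1 + t) * (1 - l) = 1" "(1 + t) * l = t"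
    using assms by (auto simp: l_def field_simps)
  have eq: "u + t * v = (1 + t) * ((1 - l) * u + l * v)"
    using l by (simp add: distrib_left flip: mult.assoc)
  have "(u + t * v) powr q = (1 + t) powr q * ((1 - l) * u + l * v) powr q"
    unfolding eq by (rule powr_mult)
  also have "\<dots> \<le> (1 + t) powr q * ((1 - l) * u powr q + l * v powr q)"
    using powr_convex_nonneg[of q u v l] assms l by (intro mult_left_mono) auto
  also have "\<dots> = (1 + t) powr (q - 1) * ((1 + t) * ((1 - l) * u powr q + l * v powr q))"
    using assms by (simp add: powr_diff)
  also have "(1 + t) * ((1 - l) * u powr q + l * v powr q) = u powr q + t * v powr q"
    using l by (simp add: distrib_left flip: mult.assoc)
  finally show ?thesis .
qed

text \<open>Each summand is at most (a+b)^p. This crude linear bound serves to place the p-sum of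
  two members of a lattice in the lattice.\<close>

lemma powr_sum_root_le:
  fixes a b p :: real
  assumes "0 < p" "0 \<le> a" "0 \<le> b"
  shows "(a powr p + b powr p) powr (1 / p) \<le> 2 powr (1 / p) * (a + b)"
proof -
  have "(a powr p + b powr p) powr (1 / p) \<le> (2 * (a + b) powr p) powr (1 / p)"
    using powr_mono2[of p a "a + b"] powr_mono2[of p b "a + b"] assms
    by (intro powr_mono2) auto
  then show ?thesis
    using assms by (simp add: powr_mult powr_powr)
qed

lemma powr_le_imp_le:
  fixes a b p :: real
  assumes "0 < p" "0 \<le> b" "a powr p \<le> b powr p"
  shows "a \<le> b"
  using powr_less_mono2[OF assms(1,2), of a] assms(3) by linarith

text \<open>The factor sgn a times the conjugate of sgn b rotates b into the direction of a.\<close>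

lemma exists_phase_norm_add:
  fixes a b :: complex
  assumes "a \<noteq> 0"
  obtains c where "cmod c = 1" "cmod (a + c * b) = cmod a + cmod b"
proof (cases "b = 0")
  case False
  have "cnj (sgn b) * b = of_real (cmod b)"
    using False complex_norm_square[of b] by (simp add: sgn_eq field_simps power2_eq_square)
  moreover have "sgn a * of_real (cmod a) = a"
    using assms by (simp add: sgn_eq)
  ultimately have "a + sgn a * cnj (sgn b) * b = sgn a * of_real (cmod a + cmod b)"
    by (simp add: distrib_left mult.assoc)
  then have "cmod (a + sgn a * cnj (sgn b) * b) = cmod a + cmod b"
    using assms by (simp add: norm_mult norm_sgn flip: of_real_add)
  then show ?thesis
    using that[of "sgn a * cnj (sgn b)"] assms False by (simp add: norm_mult norm_sgn)
qed (use that[of 1] in simp)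

text \<open>Write z = g h with g the phase of y. All i g r with r real are orthogonal to y in the
  real plane, so the real and imaginary parts of h give a = i g Im h and b = i g Re h.\<close>

lemma tangential_decomposition:
  fixes y z :: complex
  obtains a b where "z = a - \<i> * b" "Re (cnj y * a) = 0" "Re (cnj y * b) = 0"
    "cmod a \<le> cmod z" "cmod b \<le> cmod z"
proof -
  \<comment> \<open>At \<open>y = 0\<close> the orthogonality conditions are void; the value 1 keeps
    g unimodular.\<close>
  define g where "g = (if y = 0 then 1 else sgn y)"
  have norm_g: "cmod g = 1"
    by (simp add: g_def norm_sgn)
  then have g: "cnj g * g = 1" "cmod g = 1"
    using complex_norm_square[of g] by (simp_all add: mult.commute)
  have y: "cnj y = of_real (cmod y) * cnj g"
    by (auto simp: g_def sgn_eq)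
  define h where "h = cnj g * z"
  have z: "z = g * h"
    using g by (metis h_def mult.assoc mult.commute mult_1)
  have h: "cmod h = cmod z"
    using g by (simp add: h_def norm_mult)
  have tang: "Re (cnj y * (\<i> * g * of_real r)) = 0" for r
  proof -
    have yg: "cnj y * g = of_real (cmod y)"
      by (subst y) (simp add: g mult.assoc)
    have "cnj y * (\<i> * g * of_real r) = \<i> * of_real r * (cnj y * g)"
      by (simp only: mult_ac)
    then have "Re (cnj y * (\<i> * g * of_real r)) = Re (\<i> * of_real r * of_real (cmod y))"
      by (simp only: yg)
    also have "\<dots> = 0"
      by simp
    finally show ?thesis .
  qed
  show thesis
  proof (rule that)
    show "z = \<i> * g * of_real (Im h) - \<i> * (\<i> * g * of_real (Re h))"
      by (subst z, subst complex_eq[of h]) (simp add: algebra_simps flip: mult.assoc)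
    show "cmod (\<i> * g * of_real (Im h)) \<le> cmod z" "cmod (\<i> * g * of_real (Re h)) \<le> cmod z"
      using abs_Im_le_cmod[of h] abs_Re_le_cmod[of h] by (simp_all add: norm_mult g h)
  qed (rule tang)+
qed

section \<open>Norm estimates in a p-convex lattice\<close>

context banach_sequence_lattice
begin

text \<open>Convexity bounds the norm of the p-sum v of x and y, and solidity passes the bound to
  every z dominated by v. Stating it with p-th powers avoids roots in the applications.\<close>

lemma p_convex_two:
  assumes conv: "convex_const_one p X N" and p: "0 < p" and x: "x \<in> X" and y: "y \<in> X"
    and z: "\<And>k. cmod (z k) powr p \<le> cmod (x k) powr p + cmod (y k) powr p"
  shows "z \<in> X" "N z powr p \<le> N x powr p + N y powr p"
proof -
  define v where "v = (\<lambda>k. complex_of_real ((cmod (x k) powr p + cmod (y k) powr p) powr (1 / p)))"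
  \<comment> \<open>A multiple of |x| + |y| that dominates v, so that solidity yields
    \<open>v \<in> X\<close>.\<close>
  have sum_mem: "(\<lambda>k. complex_of_real (2 powr (1 / p)) * (complex_of_real (cmod (x k)) + complex_of_real (cmod (y k)))) \<in> X"
    by (rule scale_mem, rule add_mem; rule solid_mem[OF x] solid_mem[OF y]; simp)
  have v: "v \<in> X"
    using p powr_sum_root_le[of p "cmod (x _)" "cmod (y _)"]
    by (intro solid_mem[OF sum_mem]) (simp add: v_def norm_mult flip: of_real_add)
  have zv: "cmod (z k) \<le> cmod (v k)" for k
  proof -
    have "(cmod (z k) powr p) powr (1 / p) \<le> cmod (v k)"
      using z[of k] p by (simp add: v_def powr_mono2)
    then show ?thesis using p by (simp add: powr_powr)
  qed
  show zX: "z \<in> X"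
    using v zv by (rule solid_mem)
  have "\<forall>j<2. (if j = 0 then x else y) \<in> X" for j :: nat
    using x y by simp
  then have "N v \<le> (N x powr p + N y powr p) powr (1 / p)"
    using conv[unfolded convex_const_one_def, rule_format, of 2 "\<lambda>j::nat. if j = 0 then x else y"] x y
    by (simp add: v_def numeral_2_eq_2)
  then have "N z \<le> (N x powr p + N y powr p) powr (1 / p)"
    using solid_norm[OF v zv] by simp
  then have "N z powr p \<le> ((N x powr p + N y powr p) powr (1 / p)) powr p"
    using p norm_nonneg[OF zX] by (intro powr_mono2) auto
  then show "N z powr p \<le> N x powr p + N y powr p"
    using p by (simp add: powr_powr)
qed

text \<open>On disjoint supports the p-th powers of the moduli add exactly, so the p-th power of the
  norm is at most 1 + |c|^p. This number is at least 1, hence at most its own p-th power.\<close>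

lemma norm_add_disjoint_le:
  assumes conv: "convex_const_one p X N" and p: "1 \<le> p"
    and x: "x \<in> X" "N x \<le> 1" and u: "u \<in> X" "N u \<le> 1"
    and disj: "\<And>k. x k = 0 \<or> u k = 0"
  shows "N (\<lambda>k. x k + c * u k) \<le> 1 + cmod c powr p"
proof -
  have "N (\<lambda>k. x k + c * u k) powr p \<le> N x powr p + N (\<lambda>k. c * u k) powr p"
  proof (rule p_convex_two(2)[OF conv _ x(1) scale_mem[OF u(1)]])
    show "cmod (x k + c * u k) powr p \<le> cmod (x k) powr p + cmod (c * u k) powr p" for k
      using disj[of k] by auto
  qed (use p in simp)
  also have "\<dots> \<le> 1 + cmod c powr p"
    using x u p norm_nonneg powr_le1[of p "N x"] powr_le1[of p "N u"]
    by (intro add_mono) (simp_all add: norm_scale powr_mult mult_left_le)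
  also have "\<dots> \<le> (1 + cmod c powr p) powr p"
    using powr_mono[of 1 p "1 + cmod c powr p"] p by simp
  finally show ?thesis
    using powr_le_imp_le[of p "1 + cmod c powr p"] p by simp
qed

text \<open>Tangentiality kills the cross term in |x + s w|^2. Raising to the power p/2 >= 1 with
  Jensen's inequality and then using p-convexity bounds the p-th power of the norm by
  (1+s^2)^(p/2).\<close>

lemma norm_add_tangential_le:
  fixes s :: real
  assumes conv: "convex_const_one p X N" and p: "2 \<le> p"
    and x: "x \<in> X" "N x \<le> 1" and w: "w \<in> X" "N w \<le> 1"
    and tang: "\<And>k. Re (cnj (x k) * w k) = 0"
  shows "N (\<lambda>k. x k + of_real s * w k) \<le> 1 + s\<^sup>2"
proof -
  \<comment> \<open>The p-th powers of a and b are the coefficients that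
    \<open>powr_add_scaled_le\<close> produces for the exponent p/2; scaling x and w by a and b
    brings the bound into the form of \<open>p_convex_two\<close>.\<close>
  define a where "a = (1 + s\<^sup>2) powr ((p / 2 - 1) / p)"
  define b where "b = a * s\<^sup>2 powr (1 / p)"
  have pos: "0 \<le> a" "0 \<le> b" "0 < p" "0 < 1 + s\<^sup>2"
    using p by (auto simp: a_def b_def add_pos_nonneg)
  have ap: "a powr p = (1 + s\<^sup>2) powr (p / 2 - 1)" and bp: "b powr p = a powr p * s\<^sup>2"
    using p pos by (simp_all add: a_def b_def powr_powr powr_mult)
  have "N (\<lambda>k. x k + of_real s * w k) powr p
      \<le> N (\<lambda>k. of_real a * x k) powr p + N (\<lambda>k. of_real b * w k) powr p"
  proof (rule p_convex_two(2)[OF conv pos(3) scale_mem[OF x(1)] scale_mem[OF w(1)]])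
    fix k
    have "(cmod (x k + of_real s * w k))\<^sup>2
        = (cmod (x k))\<^sup>2 + s\<^sup>2 * (cmod (w k))\<^sup>2 + 2 * s * Re (cnj (x k) * w k)"
      unfolding cmod_power2 by (simp add: power2_eq_square algebra_simps)
    then have sq: "(cmod (x k + of_real s * w k))\<^sup>2 = (cmod (x k))\<^sup>2 + s\<^sup>2 * (cmod (w k))\<^sup>2"
      using tang[of k] by simp
    have half: "r powr p = (r\<^sup>2) powr (p / 2)" if "0 \<le> r" for r :: real
      using that by (cases "r = 0") (simp_all add: powr_powr flip: powr_numeral)
    show "cmod (x k + of_real s * w k) powr p
        \<le> cmod (of_real a * x k) powr p + cmod (of_real b * w k) powr p"
      using powr_add_scaled_le[of "p / 2" "(cmod (x k))\<^sup>2" "(cmod (w k))\<^sup>2" "s\<^sup>2"] p pos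
      by (simp add: norm_mult powr_mult ap bp half sq algebra_simps)
  qed
  also have "\<dots> \<le> a powr p * 1 + b powr p * 1"
    using x w p pos norm_nonneg powr_le1[of p "N x"] powr_le1[of p "N w"]
    by (intro add_mono) (simp_all add: norm_scale powr_mult mult_left_le)
  also have "\<dots> = (1 + s\<^sup>2) powr (p / 2)"
    using pos powr_add[of "1 + s\<^sup>2" "p / 2 - 1" 1] by (simp add: bp ap distrib_left)
  also have "\<dots> \<le> (1 + s\<^sup>2) powr p"
    using p by (intro powr_mono) auto
  finally show ?thesis
    using powr_le_imp_le[OF pos(3)] pos(4) by simp
qed

lemma coord_proj_mem:
  assumes "x \<in> X"
  shows "coord_proj F x \<in> X" "N (coord_proj F x) \<le> N x"
    and "(\<lambda>k. x k - coord_proj F x k) \<in> X" "N (\<lambda>k. x k - coord_proj F x k) \<le> N x"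
proof -
  have le: "cmod (coord_proj F x k) \<le> cmod (x k)" "cmod (x k - coord_proj F x k) \<le> cmod (x k)" for k
    by (simp_all add: coord_proj_def)
  show "coord_proj F x \<in> X" "N (coord_proj F x) \<le> N x"
    "(\<lambda>k. x k - coord_proj F x k) \<in> X" "N (\<lambda>k. x k - coord_proj F x k) \<le> N x"
    using solid_mem[OF assms le(1)] solid_norm[OF assms le(1)]
      solid_mem[OF assms le(2)] solid_norm[OF assms le(2)] .
qed

end

section \<open>Bounds for continuous bilinear forms\<close>

context normed_sequence_space
begin

lemma openin_contains_scaled_unit_ball:
  assumes "openin (Metric_space.mtopology X (seq_dist X N)) U" "(\<lambda>k. 0) \<in> U"
  obtains r :: real where "0 < r" "\<And>x. x \<in> unit_ball X N \<Longrightarrow> (\<lambda>k. of_real r * x k) \<in> U"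
proof -
  interpret M: Metric_space X "seq_dist X N"
    by (rule Metric_space_seq_dist)
  obtain e where e: "0 < e" "M.mball (\<lambda>k. 0) e \<subseteq> U"
    using assms M.openin_mtopology by blast
  \<comment> \<open>Halving the radius carries the closed unit ball into the open ball of radius
    e.\<close>
  have "(\<lambda>k. of_real (e / 2) * x k) \<in> U" if "x \<in> unit_ball X N" for x
  proof -
    have x: "x \<in> X" "N x \<le> 1"
      using that by (auto simp: unit_ball_def)
    have "e * N x \<le> e * 1"
      using x e by (intro mult_left_mono) auto
    then have "e / 2 * N x < e"
      using e by simp
    moreover have "N (\<lambda>k. 0 - of_real (e / 2) * x k) = e / 2 * N x"
      using e norm_scale[OF x(1), of "- of_real (e / 2)"] by simp
    ultimately have "N (\<lambda>k. 0 - of_real (e / 2) * x k) < e"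
      by linarith
    then show ?thesis
      using e scale_mem[OF x(1), of "of_real (e / 2)"] zero_mem
      by (intro subsetD[OF e(2)]) (simp add: seq_dist_def)
  qed
  then show thesis
    using e that[of "e / 2"] by simp
qed

end

lemma bilinear_form_on_swap:
  "bilinear_form_on X Y A \<Longrightarrow> bilinear_form_on Y X (\<lambda>y x. A x y)"
  unfolding bilinear_form_on_def by blast

lemma bilinear_form_on_rules:
  assumes "bilinear_form_on X Y A"
  shows "\<lbrakk>x \<in> X; x' \<in> X; y \<in> Y\<rbrakk> \<Longrightarrow> A (\<lambda>k. x k + x' k) y = A x y + A x' y"
    and "\<lbrakk>x \<in> X; y \<in> Y\<rbrakk> \<Longrightarrow> A (\<lambda>k. c * x k) y = c * A x y"
    and "\<lbrakk>x \<in> X; y \<in> Y; y' \<in> Y\<rbrakk> \<Longrightarrow> A x (\<lambda>k. y k + y' k) = A x y + A x y'"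
    and "\<lbrakk>x \<in> X; y \<in> Y\<rbrakk> \<Longrightarrow> A x (\<lambda>k. c * y k) = c * A x y"
  using assms unfolding bilinear_form_on_def by blast+

text \<open>Continuity at the origin gives |A| < 1 on a product of neighbourhoods containing the r-
  and s-multiples of the unit balls; homogeneity turns this into the bound 1/(r s). It makes the
  supremum in \<open>form_norm\<close> meaningful.\<close>

lemma continuous_bilinear_form_bdd_above:
  assumes X: "normed_sequence_space X NX" and Y: "normed_sequence_space Y NY"
    and A: "A \<in> continuous_bilinear_forms X NX Y NY"
  shows "bdd_above {cmod (A x y) |x y. x \<in> unit_ball X NX \<and> y \<in> unit_ball Y NY}"
proof -
  interpret X: normed_sequence_space X NX by (rule X)
  interpret Y: normed_sequence_space Y NY by (rule Y)
  interpret MX: Metric_space X "seq_dist X NX" by (rule X.Metric_space_seq_dist)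
  interpret MY: Metric_space Y "seq_dist Y NY" by (rule Y.Metric_space_seq_dist)
  have bil: "bilinear_form_on X Y A"
    and cont: "continuous_map (prod_topology MX.mtopology MY.mtopology) euclidean (\<lambda>(x, y). A x y)"
    using A by (auto simp: continuous_bilinear_forms_def)
  note A_rules = bilinear_form_on_rules[OF bil]
  define S where "S = {z \<in> X \<times> Y. (case z of (x, y) \<Rightarrow> A x y) \<in> ball 0 1}"
  have "openin (prod_topology MX.mtopology MY.mtopology) S"
    using openin_continuous_map_preimage[OF cont, of "ball 0 1"] by (simp add: S_def)
  moreover have "(\<lambda>k. 0, \<lambda>k. 0) \<in> S"
    using A_rules(2)[OF X.zero_mem Y.zero_mem, of 0] X.zero_mem Y.zero_mem by (simp add: S_def)
  ultimately have "\<exists>U V. openin MX.mtopology U \<and> openin MY.mtopology V \<and>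
      (\<lambda>k. 0) \<in> U \<and> (\<lambda>k. 0) \<in> V \<and> U \<times> V \<subseteq> S"
    by (rule openin_prod_topology_alt[THEN iffD1, rule_format])
  then obtain U V where UV: "openin MX.mtopology U" "openin MY.mtopology V"
      "(\<lambda>k. 0) \<in> U" "(\<lambda>k. 0) \<in> V" "U \<times> V \<subseteq> S"
    by auto
  obtain r where r: "0 < r" "\<And>x. x \<in> unit_ball X NX \<Longrightarrow> (\<lambda>k. of_real r * x k) \<in> U"
    using X.openin_contains_scaled_unit_ball UV by metis
  obtain s where s: "0 < s" "\<And>y. y \<in> unit_ball Y NY \<Longrightarrow> (\<lambda>k. of_real s * y k) \<in> V"
    using Y.openin_contains_scaled_unit_ball UV by metis
  have "cmod (A x y) \<le> 1 / (r * s)" if x: "x \<in> unit_ball X NX" and y: "y \<in> unit_ball Y NY" for x y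
  proof -
    have mem: "x \<in> X" "y \<in> Y"
      using x y by (auto simp: unit_ball_def)
    have "cmod (A (\<lambda>k. of_real r * x k) (\<lambda>k. of_real s * y k)) < 1"
      using r(2)[OF x] s(2)[OF y] UV(5) by (auto simp: S_def)
    then have "r * s * cmod (A x y) < 1"
      using mem r s X.scale_mem Y.scale_mem by (simp add: A_rules norm_mult)
    then show ?thesis
      using r s by (simp add: field_simps)
  qed
  then show ?thesis
    by (intro bdd_aboveI[of _ "1 / (r * s)"]) auto
qed

text \<open>Apply the norm bound to x/a and y/b. Dividing by positive upper bounds instead of the
  norms covers zero vectors as well.\<close>

lemma form_unit_ball_bound:
  assumes X: "normed_sequence_space X NX" and Y: "normed_sequence_space Y NY"
    and A: "A \<in> form_unit_ball X NX Y NY"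
    and x: "x \<in> X" "NX x \<le> a" "0 < a" and y: "y \<in> Y" "NY y \<le> b" "0 < b"
  shows "cmod (A x y) \<le> a * b"
proof -
  interpret X: normed_sequence_space X NX by (rule X)
  interpret Y: normed_sequence_space Y NY by (rule Y)
  have cont: "A \<in> continuous_bilinear_forms X NX Y NY" and le: "form_norm X NX Y NY A \<le> 1"
    using A by (auto simp: form_unit_ball_def)
  then have "bilinear_form_on X Y A"
    by (simp add: continuous_bilinear_forms_def)
  note A_rules = bilinear_form_on_rules[OF this]
  define x' where "x' = (\<lambda>k. of_real (1 / a) * x k)"
  define y' where "y' = (\<lambda>k. of_real (1 / b) * y k)"
  have "x' \<in> unit_ball X NX" "y' \<in> unit_ball Y NY"
    using x y X.scale_mem[OF x(1), of "of_real (1 / a)"] Y.scale_mem[OF y(1), of "of_real (1 / b)"]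
      X.norm_scale[OF x(1), of "of_real (1 / a)"] Y.norm_scale[OF y(1), of "of_real (1 / b)"]
    by (simp_all add: unit_ball_def x'_def y'_def norm_divide)
  then have "cmod (A x' y') \<le> form_norm X NX Y NY A"
    unfolding form_norm_def
    by (intro cSup_upper continuous_bilinear_form_bdd_above[OF X Y cont]) auto
  moreover have "A x' y' = of_real (1 / a) * (of_real (1 / b) * A x y)"
    unfolding x'_def y'_def using x y Y.scale_mem by (simp only: A_rules)
  moreover from this have "cmod (A x' y') = cmod (A x y) / (a * b)"
    using x y by (simp add: norm_mult norm_divide)
  ultimately have "cmod (A x y) / (a * b) \<le> 1"
    using le by linarith
  then show ?thesis
    using x y by (simp only: divide_le_eq_1_pos mult_pos_pos)
qed

text \<open>Reversing both signs cancels the mixed terms \<open>A u y\<close> and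
  \<open>A x w\<close>, while the coefficient c d of \<open>A u w\<close> is unchanged.\<close>

lemma bilinear_sign_average:
  assumes X: "normed_sequence_space X NX" and Y: "normed_sequence_space Y NY"
    and A: "bilinear_form_on X Y A" and mem: "x \<in> X" "u \<in> X" "y \<in> Y" "w \<in> Y"
  shows "A (\<lambda>k. x k + c * u k) (\<lambda>k. y k + d * w k)
      + A (\<lambda>k. x k + (- c) * u k) (\<lambda>k. y k + (- d) * w k) = 2 * (A x y + c * d * A u w)"
proof -
  interpret X: normed_sequence_space X NX by (rule X)
  interpret Y: normed_sequence_space Y NY by (rule Y)
  have "A (\<lambda>k. x k + c * u k) (\<lambda>k. y k + d * w k)
      = A x y + c * A u y + d * A x w + c * d * A u w" for c d
    using mem X.scale_mem Y.scale_mem Y.add_mem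
    by (simp add: bilinear_form_on_rules[OF A] algebra_simps)
  from this[of c d] this[of "- c" "- d"] show ?thesis
    by simp
qed

section \<open>Forms that almost attain their norm\<close>

text \<open>For tangential w the averaged bound (1+t^p)^2 <= 1 + 3 t^p and the lower bound 1 - t^p
  leave t s |A u w| <= 4 t^p; two tangential parts give the constant 8. The estimate
  \<open>bound\<close> is a hypothesis so that the transposed form can be treated too.\<close>

lemma form_small_off_support:
  fixes t p :: real
  assumes X: "banach_sequence_lattice X NX" and Y: "banach_sequence_lattice Y NY"
    and p: "2 < p" and convX: "convex_const_one p X NX" and convY: "convex_const_one p Y NY"
    and A: "bilinear_form_on X Y A"
    and bound: "\<And>x y a b. \<lbrakk>x \<in> X; NX x \<le> a; 0 < a; y \<in> Y; NY y \<le> b; 0 < b\<rbrakk>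
      \<Longrightarrow> cmod (A x y) \<le> a * b"
    and t: "0 < t" "t \<le> 1"
    and x0: "x0 \<in> X" "NX x0 \<le> 1" and y0: "y0 \<in> Y" "NY y0 \<le> 1"
    and large: "1 - t powr p < cmod (A x0 y0)"
    and u: "u \<in> X" "NX u \<le> 1" "\<And>k. x0 k = 0 \<or> u k = 0"
    and y: "y \<in> Y" "NY y \<le> 1"
  shows "cmod (A u y) \<le> 8 * t powr (p / 2 - 1)"
proof -
  interpret X: banach_sequence_lattice X NX by (rule X)
  interpret Y: banach_sequence_lattice Y NY by (rule Y)
  have tp: "t powr p \<le> 1" "0 < t powr p"
    using t p by (simp_all add: powr_le1)
  \<comment> \<open>This choice gives s^2 = t^p, so both perturbed vectors have norm at most 1 +
    t^p.\<close>
  define s where "s = t powr (p / 2)"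
  have s: "0 < s" "s\<^sup>2 = t powr p" "t * s = t powr (1 + p / 2)"
    using t powr_add[of t "p / 2" "p / 2"] by (simp_all add: s_def powr_add power2_eq_square)
  have small: "cmod (A u w) \<le> 4 * t powr (p / 2 - 1)"
    if w: "w \<in> Y" "NY w \<le> 1" "\<And>k. Re (cnj (y0 k) * w k) = 0" for w
  proof -
    have "A x0 y0 \<noteq> 0"
      using large tp by auto
    \<comment> \<open>The phase c is put on the perturbation of \<open>x0\<close>. Its norm estimate
      depends only on the modulus of the coefficient, and the two terms of the average now add up in
      modulus.\<close>
    then obtain c where c: "cmod c = 1"
      "cmod (A x0 y0 + c * (of_real (t * s) * A u w)) = cmod (A x0 y0) + cmod (of_real (t * s) * A u w)"
      by (rule exists_phase_norm_add)
    have le: "cmod (A (\<lambda>k. x0 k + d * u k) (\<lambda>k. y0 k + of_real r * w k)) \<le> (1 + t powr p) * (1 + t powr p)"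
      if "cmod d = t" "\<bar>r\<bar> = s" for d r
    proof (rule bound)
      show "NX (\<lambda>k. x0 k + d * u k) \<le> 1 + t powr p"
        using X.norm_add_disjoint_le[OF convX _ x0 u, of d] p that by simp
      have "r\<^sup>2 = s\<^sup>2"
        using that by (metis power2_abs)
      then show "NY (\<lambda>k. y0 k + of_real r * w k) \<le> 1 + t powr p"
        using Y.norm_add_tangential_le[OF convY _ y0 w, of r] p s by simp
    qed (use tp x0 u y0 w in \<open>auto intro!: X.add_mem X.scale_mem Y.add_mem Y.scale_mem add_pos_pos\<close>)
    have "2 * (cmod (A x0 y0) + t * s * cmod (A u w))
        = cmod (2 * (A x0 y0 + c * (of_real (t * s) * A u w)))"
      using t s(1) unfolding norm_mult c(2) by (simp add: norm_mult)
    also have "\<dots> = cmod (2 * (A x0 y0 + (c * of_real t) * of_real s * A u w))"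
      by (simp add: mult.assoc)
    also have "\<dots> = cmod (A (\<lambda>k. x0 k + (c * of_real t) * u k) (\<lambda>k. y0 k + of_real s * w k)
        + A (\<lambda>k. x0 k + (- (c * of_real t)) * u k) (\<lambda>k. y0 k + of_real (- s) * w k))"
      unfolding of_real_minus
      using bilinear_sign_average[OF X.normed_sequence_space_axioms Y.normed_sequence_space_axioms
          A x0(1) u(1) y0(1) w(1), of "c * of_real t" "of_real s"] by simp
    also have "\<dots> \<le> (1 + t powr p) * (1 + t powr p) + (1 + t powr p) * (1 + t powr p)"
      using t s c by (intro norm_triangle_le add_mono le) (simp_all add: norm_mult)
    finally have "cmod (A x0 y0) + t * s * cmod (A u w) \<le> (1 + t powr p) * (1 + t powr p)"
      by simp
    moreover have "(1 + t powr p) * (1 + t powr p) \<le> 1 + 3 * t powr p"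
      using tp mult_left_le[of "t powr p" "t powr p"] by (simp add: algebra_simps)
    ultimately have "t * s * cmod (A u w) \<le> 4 * t powr p"
      using large by linarith
    \<comment> \<open>The exponents are 1 + p/2 for t s and p/2 - 1 for the gain, which is positive
      as p > 2.\<close>
    moreover have "t powr p = t * s * t powr (p / 2 - 1)"
      unfolding s(3) by (simp flip: powr_add)
    ultimately have "t * s * cmod (A u w) \<le> t * s * (4 * t powr (p / 2 - 1))"
      by simp
    then show ?thesis
      by (rule mult_left_le_imp_le) (use t s in simp)
  qed
  \<comment> \<open>Decompose y coordinatewise; the modulus bounds keep both parts in the unit ball
    of Y by solidity.\<close>
  have "\<forall>k. \<exists>a b. y k = a - \<i> * b \<and> Re (cnj (y0 k) * a) = 0 \<and> Re (cnj (y0 k) * b) = 0 \<and>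
      cmod a \<le> cmod (y k) \<and> cmod b \<le> cmod (y k)"
    by (metis tangential_decomposition)
  then obtain w1 w2 where w: "\<And>k. y k = w1 k - \<i> * w2 k"
    "\<And>k. Re (cnj (y0 k) * w1 k) = 0" "\<And>k. Re (cnj (y0 k) * w2 k) = 0"
    "\<And>k. cmod (w1 k) \<le> cmod (y k)" "\<And>k. cmod (w2 k) \<le> cmod (y k)"
    by metis
  have mem: "w1 \<in> Y" "w2 \<in> Y" "NY w1 \<le> 1" "NY w2 \<le> 1"
    using Y.solid_mem[OF y(1) w(4)] Y.solid_mem[OF y(1) w(5)]
      Y.solid_norm[OF y(1) w(4)] Y.solid_norm[OF y(1) w(5)] y(2) by simp_all
  have "y = (\<lambda>k. w1 k + (- \<i>) * w2 k)"
    using w(1) by auto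
  then have "A u y = A u w1 + (- \<i>) * A u w2"
    using mem u Y.scale_mem by (simp only: bilinear_form_on_rules[OF A])
  then have "cmod (A u y) \<le> cmod (A u w1) + cmod (A u w2)"
    using norm_triangle_ineq4[of "A u w1" "\<i> * A u w2"] by (simp add: norm_mult)
  also have "\<dots> \<le> 8 * t powr (p / 2 - 1)"
    using small[of w1] small[of w2] mem w by simp
  finally show ?thesis .
qed

text \<open>With P and Q the projections, A(x, y) - A(Px, Qy) = A(Px, y - Qy) + A(x - Px, y). Each
  term has an argument vanishing on the support of \<open>x0\<close> or \<open>y0\<close>, so it is
  at most 8 t^(p/2-1).\<close>

lemma form_diff_restrict_le:
  fixes t p :: real
  assumes X: "banach_sequence_lattice X NX" and Y: "banach_sequence_lattice Y NY"
    and p: "2 < p" and convX: "convex_const_one p X NX" and convY: "convex_const_one p Y NY"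
    and A: "A \<in> form_unit_ball X NX Y NY"
    and t: "0 < t" "t \<le> 1"
    and x0: "x0 \<in> unit_sphere X NX" "supported_on x0 F"
    and y0: "y0 \<in> unit_sphere Y NY" "supported_on y0 G"
    and large: "1 - t powr p < cmod (A x0 y0)"
  shows "form_norm X NX Y NY (\<lambda>x y. A x y - restrict_form F G A x y) \<le> 16 * t powr (p / 2 - 1)"
proof -
  interpret X: banach_sequence_lattice X NX by (rule X)
  interpret Y: banach_sequence_lattice Y NY by (rule Y)
  have bil: "bilinear_form_on X Y A"
    using A by (simp add: form_unit_ball_def continuous_bilinear_forms_def)
  note A_rules = bilinear_form_on_rules[OF bil]
  have bound: "cmod (A x y) \<le> a * b"
    if "x \<in> X" "NX x \<le> a" "0 < a" "y \<in> Y" "NY y \<le> b" "0 < b" for x y a b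
    using that by (rule form_unit_ball_bound[OF X.normed_sequence_space_axioms Y.normed_sequence_space_axioms A])
  have bound': "cmod (A x y) \<le> b * a"
    if "y \<in> Y" "NY y \<le> b" "0 < b" "x \<in> X" "NX x \<le> a" "0 < a" for x y a b
    using bound[of x a y b] that by (simp add: mult.commute)
  have base: "x0 \<in> X" "NX x0 \<le> 1" "y0 \<in> Y" "NY y0 \<le> 1"
    using x0 y0 by (auto simp: unit_sphere_def)
  have "cmod (A x y - restrict_form F G A x y) \<le> 16 * t powr (p / 2 - 1)"
    if "x \<in> unit_ball X NX" "y \<in> unit_ball Y NY" for x y
  proof -
    have xy: "x \<in> X" "NX x \<le> 1" "y \<in> Y" "NY y \<le> 1"
      using that by (auto simp: unit_ball_def)
    define u where "u = (\<lambda>k. x k - coord_proj F x k)"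
    define v where "v = (\<lambda>k. y k - coord_proj G y k)"
    have u: "u \<in> X" "NX u \<le> 1" "\<And>k. x0 k = 0 \<or> u k = 0"
      using X.coord_proj_mem(3,4)[OF xy(1), of F] xy x0
      by (auto simp: u_def supported_on_def coord_proj_def)
    have v: "v \<in> Y" "NY v \<le> 1" "\<And>k. y0 k = 0 \<or> v k = 0"
      using Y.coord_proj_mem(3,4)[OF xy(3), of G] xy y0
      by (auto simp: v_def supported_on_def coord_proj_def)
    have Px: "coord_proj F x \<in> X" "NX (coord_proj F x) \<le> 1"
      using X.coord_proj_mem(1,2)[OF xy(1), of F] xy by auto
    have Py: "coord_proj G y \<in> Y"
      using Y.coord_proj_mem(1)[OF xy(3), of G] by auto
    have "A x y = A (\<lambda>k. coord_proj F x k + u k) y"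
      by (simp add: u_def)
    also have "\<dots> = A (coord_proj F x) y + A u y"
      using Px u xy by (simp add: A_rules)
    also have "A (coord_proj F x) y = A (coord_proj F x) (\<lambda>k. coord_proj G y k + v k)"
      by (simp add: v_def)
    also have "\<dots> = restrict_form F G A x y + A (coord_proj F x) v"
      using Px Py v by (simp add: A_rules restrict_form_def)
    finally have "A x y - restrict_form F G A x y = A (coord_proj F x) v + A u y"
      by simp
    moreover have "cmod (A u y) \<le> 8 * t powr (p / 2 - 1)"
      by (rule form_small_off_support[OF X Y p convX convY bil bound t base large u xy(3,4)])
    \<comment> \<open>Same estimate for the transposed form: v is the off-support argument and the
      projection of x the arbitrary one.\<close>
    moreover have "cmod (A (coord_proj F x) v) \<le> 8 * t powr (p / 2 - 1)"
      by (rule form_small_off_support[OF Y X p convY convX bilinear_form_on_swap[OF bil] bound' t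
          base(3,4,1,2) large v Px])
    ultimately show ?thesis
      using norm_triangle_ineq[of "A (coord_proj F x) v" "A u y"] by simp
  qed
  \<comment> \<open>The set of values is nonempty, as bounding its real supremum requires.\<close>
  moreover have "(\<lambda>k. 0) \<in> unit_ball X NX" "(\<lambda>k. 0) \<in> unit_ball Y NY"
    using X.zero_mem Y.zero_mem X.norm_eq_0_iff[OF X.zero_mem] Y.norm_eq_0_iff[OF Y.zero_mem]
    by (simp_all add: unit_ball_def)
  ultimately show ?thesis
    unfolding form_norm_def by (intro cSup_least) auto
qed

section \<open>Choice of the threshold\<close>

theorem theorem3p5:
  fixes X Y :: "(nat \<Rightarrow> complex) set"
    and NX NY :: "(nat \<Rightarrow> complex) \<Rightarrow> real"
    and p :: real
  assumes "banach_sequence_lattice X NX"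
    and "banach_sequence_lattice Y NY"
    and "p > 2"
    and "convex_const_one p X NX"
    and "convex_const_one p Y NY"
  shows "\<forall>\<epsilon>::real. \<epsilon> > 0 \<longrightarrow> (\<exists>\<eta>::real. \<eta> > 0 \<and>
    (\<forall>F G x0 y0 A.
       finite F \<and> finite G \<and>
       x0 \<in> unit_sphere X NX \<and> supported_on x0 F \<and>
       y0 \<in> unit_sphere Y NY \<and> supported_on y0 G \<and>
       A \<in> form_unit_ball X NX Y NY \<and> cmod (A x0 y0) > 1 - \<eta> \<longrightarrow>
       form_norm X NX Y NY (\<lambda>x y. A x y - restrict_form F G A x y) < \<epsilon>))"
proof (intro allI impI)
  fix \<epsilon> :: real
  assume \<epsilon>: "0 < \<epsilon>"
  define q where "q = p / 2 - 1"
  \<comment> \<open>The second entry gives 16 t^q <= \<epsilon>/2 < \<epsilon>; the cap 1 is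
    required by the estimates. The threshold will be t^p.\<close>
  define t where "t = min 1 ((\<epsilon> / 32) powr (1 / q))"
  have q: "0 < q"
    using assms(3) by (simp add: q_def)
  have t: "0 < t" "t \<le> 1"
    using \<epsilon> by (simp_all add: t_def)
  have "t powr q \<le> ((\<epsilon> / 32) powr (1 / q)) powr q"
    using q t by (intro powr_mono2) (auto simp: t_def)
  then have "16 * t powr (p / 2 - 1) < \<epsilon>"
    using q \<epsilon> by (simp add: powr_powr flip: q_def)
  then have close: "form_norm X NX Y NY (\<lambda>x y. A x y - restrict_form F G A x y) < \<epsilon>"
    if "x0 \<in> unit_sphere X NX" "supported_on x0 F" "y0 \<in> unit_sphere Y NY" "supported_on y0 G"
      "A \<in> form_unit_ball X NX Y NY" "1 - t powr p < cmod (A x0 y0)" for F G x0 y0 A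
    using form_diff_restrict_le[OF assms that(5) t that(1-4,6)] by linarith
  show "\<exists>\<eta>::real. \<eta> > 0 \<and>
    (\<forall>F G x0 y0 A.
       finite F \<and> finite G \<and>
       x0 \<in> unit_sphere X NX \<and> supported_on x0 F \<and>
       y0 \<in> unit_sphere Y NY \<and> supported_on y0 G \<and>
       A \<in> form_unit_ball X NX Y NY \<and> cmod (A x0 y0) > 1 - \<eta> \<longrightarrow>
       form_norm X NX Y NY (\<lambda>x y. A x y - restrict_form F G A x y) < \<epsilon>)"
  proof (intro exI[of _ "t powr p"] conjI allI impI; (elim conjE)?)
    show "0 < t powr p"
      using t by simp
  qed (rule close)
qed

end
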